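(* Let $f\in B\mathcal S_{\mathbf M}$ have a Fourier series of the form $(F)$ (see context) and let $\alpha\ge1$. Then for every $0<\tau\le\frac{3\pi}4$ and $n\in\mathbb N$, $$E_{\lambda_n}(f)_{\mathbf M}\le\frac{1}{2^\alpha\int_0^\tau\sin^\alpha\frac t2\,dt}\int_0^\tau\omega_\alpha\Big(f,\frac t{\lambda_n}\Big)_{\mathbf M}dt.$$ This relation becomes an equality for the functions $f^*(x)=\gamma+\beta e^{-i\lambda_nx}+\delta e^{i\lambda_nx}$, where $\gamma,\beta,\delta$ are arbitrary complex numbers.
   Context: Almost periodic functions. A locally Lebesgue integrable $f:\mathbb R\to\mathbb C$ is called $B$-a.p. (Besicovitch almost periodic of order 1) if there are trigonometric sums $\tau_N(x)=\sum_{k} a_k e^{i\mu_k x}$ (finite sums, $\mu_k\in\mathbb R$, $a_k\in\mathbb C$) with $\limsup_{T\to\infty}\frac1{2T}\int_{-T}^T|f-\tau_N|\,dx\to0$ as $N\to\infty$. For such $f$ the mean value $A\{f\}=\lim_{T\to\infty}\frac1T\int_0^Tf(x)\,dx$ exists, and the Fourier exponents of $f$ are the (at most countably many) $\lambda\in\mathbb R$ with $A\{f(\cdot)e^{-i\lambda\cdot}\}\ne0$. Exponents. $\{\lambda_k\}_{k\in\mathbb Z}$ is a real sequence with $\lambda_0=0$, $\lambda_{-k}=-\lambda_k$, $0<\lambda_k<\lambda_{k+1}$ for $k\ge1$, and $\lambda_k\to\infty$ as $k\to\infty$. All functions considered are $B$-a.p. with all Fourier exponents in $\{\lambda_k\}_{k\in\mathbb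 Z}$; put $A_k(f)=A\{f(\cdot)e^{-i\lambda_k\cdot}\}$ (for the functions $f^*$ these coefficients vanish unless $k\in\{0,\pm n\}$). We say $f$ has a Fourier series of the form $(F)$ if its Fourier series is $\sum_{k\in\mathbb Z}A_k(f)e^{i\lambda_kx}$ with $|A_k(f)|+|A_{-k}(f)|>0$ for all $k\ge 1$. The space. $\mathbf M=\{M_k\}_{k\in\mathbb Z}$ is a sequence of Orlicz functions: each $M_k:[0,\infty)\to[0,\infty)$ is nondecreasing and convex, $M_k(0)=0$, $M_k(t)\to\infty$ as $t\to\infty$. Let $M_k^*(v)=\sup\{uv-M_k(u):u\ge0\}$, and let $\Gamma$ be the set of sequences of positive numbers $\gamma=\{\gamma_k\}_{k\in\mathbb Z}$ with $\sum_{k\in\mathbb Z}M_k^*(\gamma_k)\le1$. The space $B\mathcal S_{\mathbf M}$ consists of those functions $f$ for which $\|f\|_{\mathbf M}:=\sup\{\sum_{k\in\mathbb Z}\gamma_k|A_k(f)|:\gamma\in\Gamma\}<\infty$; functions with the same Fourier series are identified. Best approximation. $E_{\lambda_n}(f)_{\mathbf M}=\inf\|f-g\|_{\mathbf M}$, the infimum over all $g$ whose Fourier exponents lie in the interval $(-\lambda_n,\lambda_n)$. Modulus of smoothness of order $\alpha>0$. With $\varphi_\alpha(t)=2^{\alpha/2}(1-\cos t)^{\alpha/2}=2^\alpha|\sin(t/2)|^\alpha$, for $\delta\ge0$, $$\omega_\alpha(f,\delta)_{\mathbf M}=\sup_{|h|\le\delta}\ \sup\Big\{\sum_{k\in\mathbb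 Z}\gamma_k\varphi_\alpha(\lambda_kh)|A_k(f)|:\gamma\in\Gamma\Big\}.$$ *)

theory Defs
  imports "HOL-Analysis.Analysis"
begin

section \<open>Besicovitch almost periodic functions\<close>

definition trig_sum :: "(real \<Rightarrow> complex) \<Rightarrow> bool" where
  "trig_sum p \<longleftrightarrow>
     (\<exists>K a. finite K \<and> p = (\<lambda>x. \<Sum>\<mu>\<in>K. a \<mu> * cis (\<mu> * x)))"

definition B_ap :: "(real \<Rightarrow> complex) \<Rightarrow> bool" where
  "B_ap f \<longleftrightarrow>
     (\<forall>a b. f absolutely_integrable_on {a..b}) \<and>
     (\<exists>p :: nat \<Rightarrow> real \<Rightarrow> complex. (\<forall>N. trig_sum (p N)) \<and>
        (\<lambda>N. Limsup at_top (\<lambda>T. ereal (1 / (2 * T) * integral {-T..T} (\<lambda>x. cmod (f x - p N x)))))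
          \<longlonglongrightarrow> 0)"

definition mean_value :: "(real \<Rightarrow> complex) \<Rightarrow> complex" where
  "mean_value f = Lim at_top (\<lambda>T. (1 / T) *\<^sub>R integral {0..T} f)"

definition fourier_coeff :: "(real \<Rightarrow> complex) \<Rightarrow> real \<Rightarrow> complex" where
  "fourier_coeff f \<mu> = mean_value (\<lambda>x. f x * cis (- \<mu> * x))"

definition fourier_exponents :: "(real \<Rightarrow> complex) \<Rightarrow> real set" where
  "fourier_exponents f = {\<mu>. fourier_coeff f \<mu> \<noteq> 0}"

definition exponent_seq :: "(int \<Rightarrow> real) \<Rightarrow> bool" where
  "exponent_seq lam \<longleftrightarrow>
     lam 0 = 0 \<and> (\<forall>k. lam (- k) = - lam k) \<and>
     (\<forall>k\<ge>1. 0 < lam k \<and> lam k < lam (k + 1)) \<and>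
     filterlim lam at_top at_top"

definition B_ap_exponents :: "(int \<Rightarrow> real) \<Rightarrow> (real \<Rightarrow> complex) set" where
  "B_ap_exponents lam = {f. B_ap f \<and> fourier_exponents f \<subseteq> range lam}"

definition form_F :: "(int \<Rightarrow> real) \<Rightarrow> (real \<Rightarrow> complex) \<Rightarrow> bool" where
  "form_F lam f \<longleftrightarrow> f \<in> B_ap_exponents lam \<and>
     (\<forall>k\<ge>1. cmod (fourier_coeff f (lam k)) + cmod (fourier_coeff f (lam (- k))) > 0)"

section \<open>Musielak--Orlicz type spaces of almost periodic functions\<close>

definition orlicz_function :: "(real \<Rightarrow> real) \<Rightarrow> bool" where
  "orlicz_function M \<longleftrightarrow>
     (\<forall>t\<ge>0. 0 \<le> M t) \<and> mono_on {0..} M \<and> convex_on {0..} M \<and>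
     M 0 = 0 \<and> filterlim M at_top at_top"

text \<open>The conjugate function may be infinite. The embedding of the reals into
  \<^typ>\<open>ennreal\<close> truncates negative numbers to 0, which does not affect the supremum, since
  \<open>u = 0\<close> contributes the value \<open>- M 0 = 0\<close>.\<close>

definition conj_fun :: "(real \<Rightarrow> real) \<Rightarrow> real \<Rightarrow> ennreal" where
  "conj_fun M v = (SUP u\<in>{0..}. ennreal (u * v - M u))"

definition Gamma_set :: "(int \<Rightarrow> real \<Rightarrow> real) \<Rightarrow> (int \<Rightarrow> real) set" where
  "Gamma_set M = {\<gamma>. (\<forall>k. 0 < \<gamma> k) \<and> (\<Sum>\<^sub>\<infinity>k\<in>UNIV. conj_fun (M k) (\<gamma> k)) \<le> 1}"

text \<open>The norm, the best approximation and the modulus of smoothness take values in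
  \<open>[0, \<infinity>]\<close>, so the sums, suprema and infima below always exist. They depend on the functions
  only through their Fourier coefficients, so functions with the same Fourier series need
  not be identified explicitly.\<close>

definition BS_norm ::
    "(int \<Rightarrow> real) \<Rightarrow> (int \<Rightarrow> real \<Rightarrow> real) \<Rightarrow> (real \<Rightarrow> complex) \<Rightarrow> ennreal" where
  "BS_norm lam M f =
     (SUP \<gamma>\<in>Gamma_set M. \<Sum>\<^sub>\<infinity>k\<in>UNIV. ennreal (\<gamma> k * cmod (fourier_coeff f (lam k))))"

definition BS_space ::
    "(int \<Rightarrow> real) \<Rightarrow> (int \<Rightarrow> real \<Rightarrow> real) \<Rightarrow> (real \<Rightarrow> complex) set" where
  "BS_space lam M = {f \<in> B_ap_exponents lam. BS_norm lam M f < \<infinity>}"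

definition best_approx ::
    "(int \<Rightarrow> real) \<Rightarrow> (int \<Rightarrow> real \<Rightarrow> real) \<Rightarrow> real \<Rightarrow> (real \<Rightarrow> complex) \<Rightarrow> ennreal" where
  "best_approx lam M r f =
     (INF g\<in>{g \<in> B_ap_exponents lam. fourier_exponents g \<subseteq> {-r<..<r}}.
        BS_norm lam M (\<lambda>x. f x - g x))"

definition phi :: "real \<Rightarrow> real \<Rightarrow> real" where
  "phi \<alpha> t = 2 powr (\<alpha> / 2) * (1 - cos t) powr (\<alpha> / 2)"

lemma phi_eq_sin: "phi \<alpha> t = 2 powr \<alpha> * \<bar>sin (t / 2)\<bar> powr \<alpha>"
proof -
  have "2 * (1 - cos t) = (2 * \<bar>sin (t / 2)\<bar>) ^ 2"
    using cos_double_sin[of "t / 2"] by (simp add: power_mult_distrib)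
  then have "phi \<alpha> t = ((2 * \<bar>sin (t / 2)\<bar>) ^ 2) powr (\<alpha> / 2)"
    by (metis phi_def powr_mult)
  also have "(2 * \<bar>sin (t / 2)\<bar>) ^ 2 = (2 * \<bar>sin (t / 2)\<bar>) powr 2"
    using powr_numeral[of "2 * \<bar>sin (t / 2)\<bar>" "num.Bit0 num.One"] by simp
  finally have "phi \<alpha> t = (2 * \<bar>sin (t / 2)\<bar>) powr \<alpha>"
    by (simp only: powr_powr) simp
  then show ?thesis
    by (simp add: powr_mult)
qed

definition modulus ::
    "(int \<Rightarrow> real) \<Rightarrow> (int \<Rightarrow> real \<Rightarrow> real) \<Rightarrow> real \<Rightarrow> (real \<Rightarrow> complex) \<Rightarrow> real \<Rightarrow> ennreal" where
  "modulus lam M \<alpha> f \<delta> =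
     (SUP h\<in>{h. \<bar>h\<bar> \<le> \<delta>}. SUP \<gamma>\<in>Gamma_set M.
        \<Sum>\<^sub>\<infinity>k\<in>UNIV. ennreal (\<gamma> k * phi \<alpha> (lam k * h) * cmod (fourier_coeff f (lam k))))"

end

theory Submission imports Defs begin

text \<open>The norm of \<open>f\<close> is a supremum of weighted sums of the absolute values of its Fourier coefficients.
  Therefore its best approximation by functions with exponents inside \<open>{- lam n<..<lam n}\<close> equals
  the norm of the tail of the coefficients with \<open>\<bar>k\<bar> \<ge> n\<close> (\<open>best_approx_eq_tail_norm\<close>). This
  uses that the Fourier coefficients of almost periodic functions exist as limits, hence are additive
  (\<open>fourier_coeff_diff\<close>), and that those of a trigonometric sum are the obvious ones.

  In the modulus of smoothness at \<open>t / lam n\<close>, the coefficient with index \<open>k\<close> is multiplied by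
  \<open>2 powr \<alpha> * \<bar>sin (\<theta> * t / 2)\<bar> powr \<alpha>\<close> with \<open>\<theta> = \<bar>lam k\<bar> / lam n\<close>, if the shift is \<open>t / lam n\<close>
  itself. After integration over \<open>t\<close> in \<open>{0..\<tau>}\<close>, the inequality follows coefficientwise once it is
  known that the integral of \<open>\<bar>sin (\<theta> * t / 2)\<bar> powr \<alpha>\<close>, among all \<open>\<theta> \<ge> 1\<close>, is smallest for \<open>\<theta> = 1\<close>
  (\<open>integral_sinpow_scaled_ge\<close>). This is the heart of the proof and the place where
  \<open>\<tau> \<le> 3 * pi / 4\<close> and \<open>\<alpha> \<ge> 1\<close> enter. After rescaling, it compares the mean of
  \<open>\<bar>sin (u / 2)\<bar> powr \<alpha>\<close> over \<open>{0..\<theta> * \<tau>}\<close> with the mean over \<open>{0..\<tau>}\<close>, and both are compared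
  with the mean over \<open>{0..3 * pi / 4}\<close> (\<open>integral_sinpow_initial\<close>).

  For the functions \<open>\<gamma> + \<beta> * cis (- lam n * x) + \<delta> * cis (lam n * x)\<close> only \<open>\<theta> = 1\<close> occurs in the tail,
  so the modulus at \<open>t / lam n\<close> is at most \<open>phi \<alpha> t\<close> times the norm of the tail, and integrating this
  gives the reverse inequality (\<open>integral_modulus_le_tail_norm\<close>).\<close>

section \<open>Means of powers of the sine\<close>

text \<open>This is the profile \<open>phi \<alpha>\<close> without its factor \<open>2 powr \<alpha>\<close>; the absolute value makes it
  \<open>2 * pi\<close>-periodic, and on \<open>{0..2 * pi}\<close> it rises up to \<open>pi\<close> and then falls symmetrically.\<close>
definition sinpow :: "real \<Rightarrow> real \<Rightarrow> real" where
  "sinpow \<alpha> u = \<bar>sin (u / 2)\<bar> powr \<alpha>"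

lemma sinpow_nonneg: "0 \<le> sinpow \<alpha> u"
  by (simp add: sinpow_def)

lemma continuous_on_sinpow: "\<alpha> > 0 \<Longrightarrow> continuous_on S (sinpow \<alpha>)"
  unfolding sinpow_def [abs_def]
  by (intro continuous_on_powr' continuous_intros) auto

lemma sinpow_periodic: "sinpow \<alpha> (u + 2 * pi) = sinpow \<alpha> u"
  by (simp add: sinpow_def add_divide_distrib)

lemma sinpow_reflect: "sinpow \<alpha> (2 * pi - u) = sinpow \<alpha> u"
  by (simp add: sinpow_def diff_divide_distrib)

text \<open>Since the profile is symmetric about \<open>pi\<close> and increasing before, its value at \<open>u\<close> is the
  minimum over the whole interval from \<open>u\<close> to the mirror point \<open>2 * pi - u\<close>.\<close>
lemma sinpow_mono:
  assumes "0 \<le> \<alpha>" "0 \<le> u" "u \<le> v" "v \<le> 2 * pi - u"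
  shows "sinpow \<alpha> u \<le> sinpow \<alpha> v"
proof -
  have *: "sinpow \<alpha> u \<le> sinpow \<alpha> w" if "u \<le> w" "w \<le> pi" for w
  proof -
    have "0 \<le> sin (u / 2)" "sin (u / 2) \<le> sin (w / 2)"
      using that assms by (auto intro!: sin_ge_zero simp: sin_mono_le_eq)
    then show ?thesis
      unfolding sinpow_def by (intro powr_mono2) (use assms in auto)
  qed
  show ?thesis
  proof (cases "v \<le> pi")
    case True
    then show ?thesis using * assms by auto
  next
    case False
    then show ?thesis using *[of "2 * pi - v"] assms by (simp add: sinpow_reflect)
  qed
qed

lemma powr_ge_tangent:
  fixes q r \<alpha> :: real
  assumes "\<alpha> \<ge> 1" "q > 0" "r \<ge> 0"
  shows "q powr \<alpha> + \<alpha> * q powr (\<alpha> - 1) * (r - q) \<le> r powr \<alpha>"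
proof (cases "r = 0")
  case True
  have "q powr \<alpha> = q powr (\<alpha> - 1) * q"
    using assms by (simp add: powr_diff)
  then have "q powr \<alpha> \<le> \<alpha> * q powr (\<alpha> - 1) * q"
    using assms by simp
  then show ?thesis
    using True assms by simp
next
  case False
  have "\<alpha> * q powr (\<alpha> - 1) * (r - q) \<le> r powr \<alpha> - q powr \<alpha>"
  proof (rule convex_on_imp_above_tangent [where A = "{0<..}"])
    show "convex_on {0<..} (\<lambda>x. x powr \<alpha>)"
      using assms by (intro powr_convex)
    show "((\<lambda>x. x powr \<alpha>) has_field_derivative \<alpha> * q powr (\<alpha> - 1)) (at q within {0<..})"
      by (rule has_field_derivative_at_within, rule has_real_derivative_powr) (use assms in auto)
  qed (use False assms in \<open>auto simp: interior_open\<close>)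
  then show ?thesis by simp
qed

lemma integral_initial_step:
  fixes g :: "real \<Rightarrow> real"
  assumes "continuous_on UNIV g" "0 \<le> a" "a \<le> b" and m: "\<And>t. a \<le> t \<Longrightarrow> t \<le> b \<Longrightarrow> m \<le> g t"
  shows "integral {0..a} g + m * (b - a) \<le> integral {0..b} g"
proof -
  have int: "g integrable_on {x..y}" for x y
    using assms(1) by (meson continuous_on_subset integrable_continuous_interval subset_UNIV)
  have "integral {a..b} (\<lambda>_. m) \<le> integral {a..b} g"
    by (rule integral_le) (use int m in auto)
  moreover have "integral {0..a} g + integral {a..b} g = integral {0..b} g"
    by (rule Henstock_Kurzweil_Integration.integral_combine) (use assms int in auto)
  ultimately show ?thesis
    using \<open>a \<le> b\<close> by (simp add: mult.commute)
qed

text \<open>This locates the point where the profile takes its mean over \<open>{0..3 * pi / 4}\<close>: not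
  before \<open>pi / 4\<close>. As \<open>x powr \<alpha>\<close> is convex for \<open>\<alpha> \<ge> 1\<close>, it lies above its tangent at
  \<open>q = sin (pi / 8)\<close>, and the mean of \<open>sin (t / 2)\<close> exceeds \<open>q\<close>, so integrating the tangent
  bound keeps at least \<open>q powr \<alpha>\<close>.\<close>
lemma sinpow_le_initial_mean:
  assumes "\<alpha> \<ge> 1"
  shows "3 * pi / 4 * sinpow \<alpha> (pi / 4) \<le> integral {0..3 * pi / 4} (sinpow \<alpha>)"
proof -
  define q where "q = sin (pi / 8)"
  have q: "q > 0" "q \<le> pi / 8"
    unfolding q_def using sin_x_le_x [of "pi / 8"] by (auto intro!: sin_gt_zero)
  \<comment> \<open>the tangent line at \<open>q\<close> evaluated at \<open>sin (t / 2)\<close>, and a primitive of it\<close>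
  define L where "L t = q powr \<alpha> + \<alpha> * q powr (\<alpha> - 1) * (sin (t / 2) - q)" for t
  define P where "P t = q powr \<alpha> * t + \<alpha> * q powr (\<alpha> - 1) * (- 2 * cos (t / 2) - q * t)" for t
  have "(L has_integral (P (3 * pi / 4) - P 0)) {0..3 * pi / 4}"
    by (rule fundamental_theorem_of_calculus)
      (auto simp: P_def [abs_def] L_def has_real_derivative_iff_has_vector_derivative [symmetric]
         intro!: derivative_eq_intros)
  moreover have "((sinpow \<alpha>) has_integral integral {0..3 * pi / 4} (sinpow \<alpha>)) {0..3 * pi / 4}"
    using assms by (intro integrable_integral integrable_continuous_interval continuous_on_sinpow) auto
  moreover have "L t \<le> sinpow \<alpha> t" if "t \<in> {0..3 * pi / 4}" for t
  proof -
    have "0 \<le> sin (t / 2)"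
      using that by (intro sin_ge_zero) auto
    then show ?thesis
      using powr_ge_tangent [of \<alpha> q "sin (t / 2)"] assms q by (simp add: L_def sinpow_def)
  qed
  ultimately have PI: "P (3 * pi / 4) - P 0 \<le> integral {0..3 * pi / 4} (sinpow \<alpha>)"
    by (rule has_integral_le)
  have PP: "P (3 * pi / 4) - P 0
      = 3 * pi / 4 * q powr \<alpha> + \<alpha> * q powr (\<alpha> - 1) * (2 - 2 * q - 3 * pi / 4 * q)"
  proof -
    have "cos (3 * pi / 8) = q"
      unfolding q_def by (simp add: cos_sin_eq field_simps)
    then show ?thesis
      by (simp add: P_def algebra_simps)
  qed
  \<comment> \<open>the integral of \<open>sin (t / 2) - q\<close>, which is nonnegative because \<open>q \<le> pi / 8 \<le> 2 / 5\<close>\<close>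
  have "0 \<le> 2 - 2 * q - 3 * pi / 4 * q"
  proof -
    have "pi \<le> 16 / 5"
      using pi_approx by simp
    then have "q \<le> 2 / 5" "3 * pi / 4 \<le> 12 / 5" using q by auto
    then have "3 * pi / 4 * q \<le> 12 / 5 * (2 / 5)"
      using q by (intro mult_mono) auto
    then show ?thesis using \<open>q \<le> 2 / 5\<close> by simp
  qed
  then have "3 * pi / 4 * q powr \<alpha>
      \<le> 3 * pi / 4 * q powr \<alpha> + \<alpha> * q powr (\<alpha> - 1) * (2 - 2 * q - 3 * pi / 4 * q)"
    unfolding le_add_same_cancel1 using assms by (intro mult_nonneg_nonneg) auto
  then show ?thesis
    using PI q unfolding PP by (simp add: sinpow_def flip: q_def)
qed

text \<open>Take for \<open>A\<close> the mean of the profile \<open>s\<close> over \<open>{0..c}\<close>, \<open>c = 3 * pi / 4\<close>, and let \<open>D x\<close> be the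
  integral of \<open>s - A\<close> over \<open>{0..x}\<close>; it vanishes at \<open>c\<close>, and its sign is to be found on either side.

  If \<open>y\<close> is the point with \<open>s y = A\<close>, then within a period \<open>D\<close> falls up to \<open>y\<close>, rises up to the
  mirror point of \<open>y\<close> and then falls again. As \<open>D 0 = D c = 0\<close>, this gives \<open>D \<le> 0\<close> up to \<open>c\<close>.
  The rest depends on comparing the gain \<open>D (2 * pi)\<close> of a full period with the lowest value \<open>D y\<close>.
  Put \<open>B = s c\<close>. By symmetry the pieces \<open>{0..c}\<close> and \<open>{2 * pi - c..2 * pi}\<close> of a period contribute
  nothing to \<open>D (2 * pi)\<close>, and on the middle piece, of length \<open>pi / 2\<close>, one has \<open>s \<ge> B\<close>. Hence the
  gain is at least \<open>(pi / 2) * (B - A)\<close>. The dip satisfies \<open>- D y \<le> (c - y) * (B - A)\<close> because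
  \<open>s \<le> B\<close> up to \<open>c\<close>, and \<open>c - y \<le> pi / 2\<close> because \<open>y \<ge> pi / 4\<close>. One full period thus pays for
  any later dip. For this comparison \<open>c = 3 * pi / 4\<close> is the largest possible choice: the length
  \<open>2 * (pi - c)\<close> of the middle piece has to be at least \<open>c - pi / 4\<close>.\<close>
lemma integral_sinpow_initial:
  assumes "\<alpha> \<ge> 1"
  obtains A where "\<And>x. 0 \<le> x \<Longrightarrow> x \<le> 3 * pi / 4 \<Longrightarrow> integral {0..x} (sinpow \<alpha>) \<le> x * A"
    and "\<And>x. 3 * pi / 4 \<le> x \<Longrightarrow> x * A \<le> integral {0..x} (sinpow \<alpha>)"
proof -
  define c where "c = 3 * pi / 4"
  have c: "0 < c" "pi / 4 \<le> c" "c \<le> pi" by (auto simp: c_def)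
  define A where "A = integral {0..c} (sinpow \<alpha>) / c"
  define B where "B = sinpow \<alpha> c"
  define g where "g t = sinpow \<alpha> t - A" for t
  define D where "D x = integral {0..x} g" for x
  have cs: "continuous_on S (sinpow \<alpha>)" for S
    using assms by (simp add: continuous_on_sinpow)
  have cg: "continuous_on S g" for S
    unfolding g_def [abs_def] using cs by (intro continuous_intros) auto
  have int: "g integrable_on {x..y}" for x y
    using cg by (rule integrable_continuous_interval)
  have mono: "sinpow \<alpha> u \<le> sinpow \<alpha> v" if "0 \<le> u" "u \<le> v" "v \<le> 2 * pi - u" for u v
    using that assms by (intro sinpow_mono) auto
  have D_eq: "D x = integral {0..x} (sinpow \<alpha>) - x * A" if "0 \<le> x" for x
    unfolding D_def g_def [abs_def] using that
    by (subst Henstock_Kurzweil_Integration.integral_diff)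
       (auto intro: integrable_continuous_interval cs)
  have D0: "D 0 = 0" and Dc: "D c = 0"
    using D_eq [of 0] D_eq [of c] c by (auto simp: A_def)
  have up: "D a + m * (b - a) \<le> D b"
    if "0 \<le> a" "a \<le> b" "\<And>t. a \<le> t \<Longrightarrow> t \<le> b \<Longrightarrow> m \<le> g t" for a b m
    unfolding D_def by (rule integral_initial_step) (use cg that in auto)
  have down: "D b \<le> D a + m * (b - a)"
    if "0 \<le> a" "a \<le> b" "\<And>t. a \<le> t \<Longrightarrow> t \<le> b \<Longrightarrow> g t \<le> m" for a b m
    using integral_initial_step [of "\<lambda>t. - g t" a b "- m"] that continuous_on_minus [OF cg]
    by (simp add: D_def)
  have "A \<le> B"
  proof -
    have "integral {0..c} (sinpow \<alpha>) \<le> integral {0..c} (\<lambda>_. B)"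
      unfolding B_def using c
      by (intro integral_le integrable_continuous_interval cs mono) auto
    then show ?thesis using c by (simp add: A_def field_simps)
  qed
  moreover have "sinpow \<alpha> (pi / 4) \<le> A"
    using sinpow_le_initial_mean [OF assms, folded c_def] c by (simp add: A_def field_simps)
  ultimately obtain y where y: "pi / 4 \<le> y" "y \<le> c" "sinpow \<alpha> y = A"
    using IVT' [of "sinpow \<alpha>" "pi / 4" A c] cs c unfolding B_def by blast
  have neg: "g t \<le> 0" if "0 \<le> t" "t \<le> y" for t
    using mono [of t y] that y c by (auto simp: g_def)
  have pos: "0 \<le> g t" if "y \<le> t" "t \<le> 2 * pi - y" for t
    using mono [of y t] that y c by (auto simp: g_def)
  have neg': "g t \<le> 0" if "2 * pi - y \<le> t" "t \<le> 2 * pi" for t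
    using neg [of "2 * pi - t"] that by (simp add: g_def sinpow_reflect)
  have initial: "D x \<le> 0" if "0 \<le> x" "x \<le> c" for x
  proof (cases "x \<le> y")
    case True
    then show ?thesis using down [of 0 x 0] neg that D0 by auto
  next
    case False
    then show ?thesis using up [of x c 0] pos that c y Dc by auto
  qed
  have gain: "pi / 2 * (B - A) \<le> D (2 * pi)"
  proof -
    \<comment> \<open>the last piece is the mirror image of \<open>{0..c}\<close>, where \<open>g\<close> has integral zero\<close>
    have "integral {2 * pi - c..2 * pi} g = integral {- (c - 2 * pi)..- (0 - 2 * pi)} (\<lambda>x. g (2 * pi - x))"
      by (simp add: g_def [abs_def] sinpow_reflect)
    also have "\<dots> = integral {0 - 2 * pi..c - 2 * pi} (\<lambda>x. g (x + 2 * pi))"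
      using Henstock_Kurzweil_Integration.integral_reflect_real [of "c - 2 * pi" "0 - 2 * pi" "\<lambda>x. g (x + 2 * pi)"]
      by (simp add: add.commute)
    also have "\<dots> = D c"
      unfolding D_def by (rule integral_shift_real_ivl)
    finally have "integral {2 * pi - c..2 * pi} g = 0"
      using Dc by simp
    moreover have "integral {0..2 * pi - c} g + integral {2 * pi - c..2 * pi} g = integral {0..2 * pi} g"
      by (rule Henstock_Kurzweil_Integration.integral_combine) (use c int in auto)
    ultimately have "D (2 * pi) = D (2 * pi - c)"
      by (simp add: D_def)
    moreover have "D c + (B - A) * (2 * pi - c - c) \<le> D (2 * pi - c)"
      by (rule up) (use c mono [of c] in \<open>auto simp: g_def B_def\<close>)
    ultimately show ?thesis
      using Dc by (simp add: c_def algebra_simps)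
  qed
  then have D2: "0 \<le> D (2 * pi)"
    using \<open>A \<le> B\<close> by (smt (verit) mult_nonneg_nonneg pi_ge_zero divide_nonneg_nonneg)
  have tail: "D (2 * pi) \<le> D x" if "2 * pi - y \<le> x" "x \<le> 2 * pi" for x
    using down [of x "2 * pi" 0] neg' that y c by auto
  have first: "0 \<le> D x" if "c \<le> x" "x \<le> 2 * pi" for x
  proof (cases "x \<le> 2 * pi - y")
    case True
    then show ?thesis using up [of c x 0] pos that c y Dc by auto
  next
    case False
    then show ?thesis using tail [of x] that D2 by auto
  qed
  \<comment> \<open>the deepest dip within a period does not exceed the gain of a period\<close>
  have low: "- D (2 * pi) \<le> D x" if "0 \<le> x" "x \<le> 2 * pi" for x
  proof -
    have "D c \<le> D y + (B - A) * (c - y)"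
      by (rule down) (use y c mono [of _ c] in \<open>auto simp: g_def B_def\<close>)
    also have "(B - A) * (c - y) \<le> (B - A) * (pi / 2)"
      using y \<open>A \<le> B\<close> by (intro mult_left_mono) (auto simp: c_def)
    finally have *: "- D (2 * pi) \<le> D y"
      using gain Dc by (simp add: mult.commute)
    consider "x \<le> y" | "y \<le> x" "x \<le> 2 * pi - y" | "2 * pi - y \<le> x" by linarith
    then show ?thesis
    proof cases
      case 1
      then show ?thesis using down [of x y 0] neg that * by auto
    next
      case 2
      then show ?thesis using up [of y x 0] pos that c y * by auto
    next
      case 3
      then show ?thesis using tail [of x] that D2 by auto
    qed
  qed
  have shift: "D (x + 2 * pi) = D (2 * pi) + D x" if "0 \<le> x" for x
  proof -
    have "integral {0..2 * pi} g + integral {2 * pi..x + 2 * pi} g = integral {0..x + 2 * pi} g"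
      by (rule Henstock_Kurzweil_Integration.integral_combine) (use that int in auto)
    moreover have "integral {2 * pi..x + 2 * pi} g = integral {0..x} (\<lambda>t. g (t + 2 * pi))"
      using integral_shift_real_ivl [of "2 * pi" "2 * pi" "x + 2 * pi" g] by simp
    ultimately show ?thesis
      by (simp add: D_def g_def [abs_def] sinpow_periodic)
  qed
  have periods: "D (x + 2 * pi * real m) = real m * D (2 * pi) + D x" if "0 \<le> x" for x m
  proof (induction m)
    case (Suc m)
    have "D (x + 2 * pi * real (Suc m)) = D ((x + 2 * pi * real m) + 2 * pi)"
      by (simp add: algebra_simps)
    also have "\<dots> = D (2 * pi) + D (x + 2 * pi * real m)"
      by (rule shift) (use that in auto)
    finally show ?case using Suc by (simp add: algebra_simps)
  qed simp
  have "0 \<le> D x" if "c \<le> x" for x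
  proof -
    define m where "m = nat \<lfloor>x / (2 * pi)\<rfloor>"
    define z where "z = x - 2 * pi * real m"
    have "real m = of_int \<lfloor>x / (2 * pi)\<rfloor>"
      using that c by (simp add: m_def)
    then have m: "real m \<le> x / (2 * pi)" "x / (2 * pi) < real m + 1"
      by linarith+
    then have z: "0 \<le> z" "z \<le> 2 * pi" "x = z + 2 * pi * real m"
      by (auto simp: z_def field_simps)
    show ?thesis
    proof (cases m)
      case 0
      then show ?thesis using first [of x] z that by auto
    next
      case (Suc k)
      have "D x = real k * D (2 * pi) + (D (2 * pi) + D z)"
        using periods [OF z(1), of m] z(3) Suc by (simp add: algebra_simps)
      then show ?thesis using low [OF z(1,2)] D2 by simp
    qed
  qed
  then show thesis
    using that [of A] initial D_eq c by (fastforce simp: c_def)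
qed

text \<open>Speeding up the argument does not decrease the integral. While \<open>\<theta> * \<tau>\<close> stays below \<open>3 * pi / 4\<close>
  the inequality holds pointwise. Beyond, the right-hand side is the mean over \<open>{0..\<theta> * \<tau>}\<close> times
  \<open>\<tau>\<close> after rescaling, and the number \<open>A\<close> of the preceding lemma separates this mean
  from the one over \<open>{0..\<tau>}\<close>.\<close>
lemma integral_sinpow_scaled_ge:
  assumes "\<alpha> \<ge> 1" "\<theta> \<ge> 1" "0 \<le> \<tau>" "\<tau> \<le> 3 * pi / 4"
  shows "integral {0..\<tau>} (sinpow \<alpha>) \<le> integral {0..\<tau>} (\<lambda>t. sinpow \<alpha> (\<theta> * t))"
proof (cases "\<theta> * \<tau> \<le> 3 * pi / 4")
  case True
  show ?thesis
  proof (rule integral_le)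
    fix t assume t: "t \<in> {0..\<tau>}"
    then have "\<theta> * t \<le> \<theta> * \<tau>" "1 * t \<le> \<theta> * t"
      using assms by (intro mult_left_mono mult_right_mono; simp)+
    moreover have "\<theta> * t + t \<le> 2 * pi"
    proof -
      have "t \<le> \<tau>" using t by simp
      then show ?thesis
        using \<open>\<theta> * t \<le> \<theta> * \<tau>\<close> True assms(4) pi_gt_zero by linarith
    qed
    ultimately show "sinpow \<alpha> t \<le> sinpow \<alpha> (\<theta> * t)"
      using t assms by (intro sinpow_mono) auto
  next
    show "sinpow \<alpha> integrable_on {0..\<tau>}" "(\<lambda>t. sinpow \<alpha> (\<theta> * t)) integrable_on {0..\<tau>}"
      using assms by (auto intro!: integrable_continuous_interval continuous_on_sinpow
          continuous_on_compose2 [OF continuous_on_sinpow [of \<alpha> UNIV]] continuous_intros)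
  qed
next
  case False
  obtain A where A: "\<And>x. 0 \<le> x \<Longrightarrow> x \<le> 3 * pi / 4 \<Longrightarrow> integral {0..x} (sinpow \<alpha>) \<le> x * A"
    "\<And>x. 3 * pi / 4 \<le> x \<Longrightarrow> x * A \<le> integral {0..x} (sinpow \<alpha>)"
    using integral_sinpow_initial [OF assms(1)] by metis
  have img: "(\<lambda>x. x / \<theta>) ` {0..\<theta> * \<tau>} = {0..\<tau>}"
    using assms by (simp add: image_divide_atLeastAtMost)
  have "integral {0..\<tau>} (\<lambda>t. sinpow \<alpha> (\<theta> * t)) = 1 / \<theta> * integral {0..\<theta> * \<tau>} (sinpow \<alpha>)"
    using integral_stretch_real [of \<theta> 0 "\<theta> * \<tau>" "sinpow \<alpha>"] assms unfolding img by simp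
  also have "\<dots> \<ge> 1 / \<theta> * (\<theta> * \<tau> * A)"
    using A(2) [of "\<theta> * \<tau>"] False assms by (intro mult_left_mono) auto
  finally show ?thesis
    using A(1) [of \<tau>] assms by simp
qed

section \<open>Fourier coefficients of almost periodic functions\<close>

text \<open>The primitive of a nonconstant \<open>cis (\<mu> * x)\<close> is bounded, so its means are \<open>O(1 / T)\<close>.\<close>
lemma mean_cis_tendsto:
  "((\<lambda>T. (1 / T) *\<^sub>R integral {0..T} (\<lambda>x. cis (\<mu> * x))) \<longlongrightarrow> (if \<mu> = 0 then 1 else 0)) at_top"
proof (cases "\<mu> = 0")
  case True
  have "\<forall>\<^sub>F T in at_top. (1 / T) *\<^sub>R integral {0..T} (\<lambda>x. cis (\<mu> * x)) = 1"
    using eventually_gt_at_top [of "0::real"]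
    by eventually_elim (simp add: True scaleR_conv_of_real)
  then show ?thesis
    using True by (simp add: tendsto_eventually)
next
  case False
  have int: "integral {0..T} (\<lambda>x. cis (\<mu> * x)) = (cis (\<mu> * T) - 1) / (\<i> * of_real \<mu>)" if "T > 0" for T
  proof -
    have "((\<lambda>x. cis (\<mu> * x)) has_integral
        (cis (\<mu> * T) / (\<i> * of_real \<mu>) - cis (\<mu> * 0) / (\<i> * of_real \<mu>))) {0..T}"
    proof (rule fundamental_theorem_of_calculus)
      fix x
      have "((\<lambda>x. exp (\<i> * of_real (\<mu> * x)) / (\<i> * of_real \<mu>)) has_vector_derivative
              exp (\<i> * of_real (\<mu> * x))) (at x within {0..T})"
      proof -
        have "((\<lambda>z. exp (\<i> * of_real \<mu> * z) / (\<i> * of_real \<mu>)) has_field_derivative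
              exp (\<i> * of_real \<mu> * of_real x)) (at (of_real x))"
          using False by - (rule derivative_eq_intros refl | simp)+
        from has_vector_derivative_real_field [OF this] show ?thesis
          by (simp add: mult.assoc)
      qed
      then show "((\<lambda>x. cis (\<mu> * x) / (\<i> * of_real \<mu>)) has_vector_derivative cis (\<mu> * x))
          (at x within {0..T})"
        by (simp add: cis_conv_exp)
    qed (use that in auto)
    then show ?thesis
      by (simp add: integral_unique diff_divide_distrib)
  qed
  have "((\<lambda>T. (1 / T) *\<^sub>R integral {0..T} (\<lambda>x. cis (\<mu> * x))) \<longlongrightarrow> 0) at_top"
  proof (rule Lim_null_comparison)
    show "\<forall>\<^sub>F T in at_top. norm ((1 / T) *\<^sub>R integral {0..T} (\<lambda>x. cis (\<mu> * x))) \<le> (2 / \<bar>\<mu>\<bar>) / T"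
      using eventually_gt_at_top [of "0::real"]
    proof eventually_elim
      case (elim T)
      have "cmod (cis (\<mu> * T) - 1) \<le> 2"
        using norm_triangle_ineq4 [of "cis (\<mu> * T)" 1] by simp
      then have "(1 / T) * (cmod (cis (\<mu> * T) - 1) / \<bar>\<mu>\<bar>) \<le> (1 / T) * (2 / \<bar>\<mu>\<bar>)"
        using elim by (intro mult_left_mono divide_right_mono) auto
      then show ?case
        using elim by (simp add: int norm_divide norm_mult mult.commute [of "\<bar>\<mu>\<bar>"])
    qed
    show "((\<lambda>T. (2 / \<bar>\<mu>\<bar>) / T) \<longlongrightarrow> 0) at_top"
      by (intro tendsto_divide_0 [OF tendsto_const] filterlim_at_top_imp_at_infinity filterlim_ident)
  qed
  then show ?thesis using False by simp
qed

lemma trig_mean_tendsto: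
  assumes "finite K"
  shows "((\<lambda>T. (1 / T) *\<^sub>R integral {0..T} (\<lambda>x. (\<Sum>\<mu>\<in>K. a \<mu> * cis (\<mu> * x)) * cis (- \<nu> * x)))
           \<longlongrightarrow> (if \<nu> \<in> K then a \<nu> else 0)) at_top"
proof -
  have eq: "(1 / T) *\<^sub>R integral {0..T} (\<lambda>x. (\<Sum>\<mu>\<in>K. a \<mu> * cis (\<mu> * x)) * cis (- \<nu> * x))
      = (\<Sum>\<mu>\<in>K. a \<mu> * ((1 / T) *\<^sub>R integral {0..T} (\<lambda>x. cis ((\<mu> - \<nu>) * x))))" for T
  proof -
    have "(\<lambda>x. (\<Sum>\<mu>\<in>K. a \<mu> * cis (\<mu> * x)) * cis (- \<nu> * x))
        = (\<lambda>x. \<Sum>\<mu>\<in>K. a \<mu> * cis ((\<mu> - \<nu>) * x))"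
    proof
      fix x
      have "(a \<mu> * cis (\<mu> * x)) * cis (- \<nu> * x) = a \<mu> * cis ((\<mu> - \<nu>) * x)" for \<mu>
        by (simp only: mult.assoc cis_mult) (simp add: left_diff_distrib)
      then show "(\<Sum>\<mu>\<in>K. a \<mu> * cis (\<mu> * x)) * cis (- \<nu> * x)
          = (\<Sum>\<mu>\<in>K. a \<mu> * cis ((\<mu> - \<nu>) * x))"
        by (simp only: sum_distrib_right)
    qed
    moreover have "integral {0..T} (\<lambda>x. \<Sum>\<mu>\<in>K. a \<mu> * cis ((\<mu> - \<nu>) * x))
        = (\<Sum>\<mu>\<in>K. a \<mu> * integral {0..T} (\<lambda>x. cis ((\<mu> - \<nu>) * x)))"
      by (subst integral_sum)
         (auto intro!: assms integrable_continuous_interval continuous_intros)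
    ultimately show ?thesis
      by (simp add: scaleR_sum_right)
  qed
  have "((\<lambda>T. \<Sum>\<mu>\<in>K. a \<mu> * ((1 / T) *\<^sub>R integral {0..T} (\<lambda>x. cis ((\<mu> - \<nu>) * x))))
      \<longlongrightarrow> (\<Sum>\<mu>\<in>K. a \<mu> * (if \<mu> - \<nu> = 0 then 1 else 0))) at_top"
    by (intro tendsto_intros mean_cis_tendsto)
  also have "(\<Sum>\<mu>\<in>K. a \<mu> * (if \<mu> - \<nu> = 0 then 1 else 0)) = (if \<nu> \<in> K then a \<nu> else 0)"
    using assms by (simp add: if_distrib cong: if_cong)
  finally show ?thesis unfolding eq .
qed

lemma fourier_coeff_trig_sum:
  assumes "finite K"
  shows "fourier_coeff (\<lambda>x. \<Sum>\<mu>\<in>K. a \<mu> * cis (\<mu> * x)) \<nu> = (if \<nu> \<in> K then a \<nu> else 0)"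
  unfolding fourier_coeff_def mean_value_def
  by (rule tendsto_Lim [OF _ trig_mean_tendsto [OF assms]]) simp

lemma trig_sum_continuous: "trig_sum p \<Longrightarrow> continuous_on S p"
  unfolding trig_sum_def by (auto intro!: continuous_intros)

lemma B_ap_trig_sum:
  assumes "trig_sum p"
  shows "B_ap p"
  unfolding B_ap_def
proof (intro conjI allI exI [of _ "\<lambda>_. p"])
  show "p absolutely_integrable_on {a..b}" for a b
    by (intro absolutely_integrable_continuous_real trig_sum_continuous assms)
qed (use assms in \<open>auto simp: Limsup_const zero_ereal_def [symmetric]\<close>)

lemma integrable_mult_cis:
  assumes "h absolutely_integrable_on {a..b}"
  shows "(\<lambda>x. h x * cis (\<nu> * x)) integrable_on {a..b}"
proof -
  have "(\<lambda>x. cis (\<nu> * x) * h x) absolutely_integrable_on {a..b}"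
    by (rule absolutely_integrable_bounded_measurable_product [OF bilinear_times])
       (use assms in \<open>auto intro!: continuous_imp_measurable_on_sets_lebesgue
          continuous_intros boundedI [of _ 1]\<close>)
  then show ?thesis
    by (simp add: mult.commute set_lebesgue_integral_eq_integral)
qed

lemma mean_diff:
  assumes "f absolutely_integrable_on {0..T}" "g absolutely_integrable_on {0..T}"
  shows "(1 / T) *\<^sub>R integral {0..T} (\<lambda>x. (f x - g x) * cis (\<nu> * x))
    = (1 / T) *\<^sub>R integral {0..T} (\<lambda>x. f x * cis (\<nu> * x))
      - (1 / T) *\<^sub>R integral {0..T} (\<lambda>x. g x * cis (\<nu> * x))"
  unfolding left_diff_distrib scaleR_diff_right [symmetric]
  by (subst Henstock_Kurzweil_Integration.integral_diff) (intro integrable_mult_cis assms refl)+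

text \<open>A definition by \<^const>\<open>Lim\<close> says nothing unless the limit exists. Here it does: for every \<open>e\<close>
  the means of \<open>f\<close> are eventually \<open>e\<close>-close to the mean value of an approximating trigonometric
  sum, so they form a Cauchy filter. The approximation is two-sided while the means are one-sided,
  which costs a factor 2.\<close>
lemma B_ap_mean_tendsto:
  assumes "B_ap f"
  shows "((\<lambda>T. (1 / T) *\<^sub>R integral {0..T} (\<lambda>x. f x * cis (- \<nu> * x))) \<longlongrightarrow> fourier_coeff f \<nu>) at_top"
proof -
  define m where "m g T = (1 / T) *\<^sub>R integral {0..T} (\<lambda>x. g x * cis (- \<nu> * x))" for g T
  have ai: "f absolutely_integrable_on {a..b}" for a b
    using assms by (auto simp: B_ap_def)
  have close: "\<exists>L. \<forall>\<^sub>F T in at_top. dist (m f T) L < e" if "e > 0" for e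
  proof -
    obtain p :: "nat \<Rightarrow> real \<Rightarrow> complex" where p: "\<And>N. trig_sum (p N)"
      "(\<lambda>N. Limsup at_top (\<lambda>T. ereal (1 / (2 * T) * integral {-T..T} (\<lambda>x. cmod (f x - p N x))))) \<longlonglongrightarrow> 0"
      using assms by (auto simp: B_ap_def)
    \<comment> \<open>\<open>e / 4\<close> for the two-sided mean becomes \<open>e / 2\<close> for the one-sided one\<close>
    have "\<forall>\<^sub>F N in sequentially.
        Limsup at_top (\<lambda>T. ereal (1 / (2 * T) * integral {-T..T} (\<lambda>x. cmod (f x - p N x)))) < ereal (e / 4)"
      by (rule order_tendstoD [OF p(2)]) (use that in auto)
    then obtain N where "Limsup at_top
        (\<lambda>T. ereal (1 / (2 * T) * integral {-T..T} (\<lambda>x. cmod (f x - p N x)))) < ereal (e / 4)"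
      by (auto simp: eventually_sequentially)
    from Limsup_lessD [OF this]
    have 1: "\<forall>\<^sub>F T in at_top. 1 / (2 * T) * integral {-T..T} (\<lambda>x. cmod (f x - p N x)) < e / 4"
      by simp
    define q where "q = p N"
    have cq: "continuous_on S q" for S
      unfolding q_def by (rule trig_sum_continuous [OF p(1)])
    obtain K a where K: "finite K" "q = (\<lambda>x. \<Sum>\<mu>\<in>K. a \<mu> * cis (\<mu> * x))"
      using p(1) [of N] by (auto simp: q_def trig_sum_def)
    define L where "L = (if \<nu> \<in> K then a \<nu> else 0)"
    have "(m q \<longlongrightarrow> L) at_top"
      unfolding m_def [abs_def] K(2) L_def by (rule trig_mean_tendsto [OF K(1)])
    then have 2: "\<forall>\<^sub>F T in at_top. dist (m q T) L < e / 2"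
      by (rule tendstoD) (use that in auto)
    have "\<forall>\<^sub>F T in at_top. dist (m f T) L < e"
      using 1 2 eventually_gt_at_top [of "0::real"]
    proof eventually_elim
      case (elim T)
      have ac: "(\<lambda>x. f x - q x) absolutely_integrable_on {a..b}" for a b
        by (intro set_integral_diff(1) ai absolutely_integrable_continuous_real cq)
      have nint: "(\<lambda>x. cmod (f x - q x)) integrable_on {a..b}" for a b
        using ac by (simp add: absolutely_integrable_on_def)
      have "m f T - m q T = (1 / T) *\<^sub>R integral {0..T} (\<lambda>x. (f x - q x) * cis (- \<nu> * x))"
        unfolding m_def
        by (rule mean_diff [symmetric])
           (intro ai absolutely_integrable_continuous_real cq)+
      also have "norm \<dots> \<le> (1 / T) * integral {0..T} (\<lambda>x. cmod (f x - q x))"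
      proof -
        have "norm (integral {0..T} (\<lambda>x. (f x - q x) * cis (- \<nu> * x)))
            \<le> integral {0..T} (\<lambda>x. cmod (f x - q x))"
          by (rule integral_norm_bound_integral)
             (intro integrable_mult_cis ac nint | simp add: norm_mult)+
        then show ?thesis
          using elim by (simp add: divide_right_mono)
      qed
      also have "\<dots> \<le> (1 / T) * integral {- T..T} (\<lambda>x. cmod (f x - q x))"
        by (intro mult_left_mono integral_subset_le)
           (use elim nint in auto)
      also have "\<dots> < e / 2"
        using elim by (simp add: q_def field_simps)
      finally have "dist (m f T) (m q T) < e / 2"
        by (simp add: dist_norm)
      then show ?case
        using elim dist_triangle [of "m f T" L "m q T"] by linarith
    qed
    then show ?thesis by blast
  qed
  have "cauchy_filter (filtermap (m f) at_top)"
    unfolding cauchy_filter_metric_filtermap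
  proof (intro allI impI)
    fix e :: real assume "e > 0"
    then obtain L where L: "\<forall>\<^sub>F T in at_top. dist (m f T) L < e / 2"
      using close [of "e / 2"] by auto
    show "\<exists>P. eventually P at_top \<and> (\<forall>x y. P x \<and> P y \<longrightarrow> dist (m f x) (m f y) < e)"
      by (intro exI conjI, rule L) (blast intro: dist_triangle_half_l)
  qed
  moreover have "\<forall>F. F \<noteq> bot \<longrightarrow> cauchy_filter F \<longrightarrow> (\<exists>L. F \<le> nhds (L :: complex))"
    using complete_UNIV [where 'a = complex] unfolding complete_uniform by simp
  moreover have "filtermap (m f) at_top \<noteq> bot"
    by (simp add: filtermap_bot_iff)
  ultimately obtain L where "filtermap (m f) at_top \<le> nhds L"
    by blast
  then have L: "(m f \<longlongrightarrow> L) at_top"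
    by (simp add: filterlim_def)
  then have "fourier_coeff f \<nu> = L"
    unfolding fourier_coeff_def mean_value_def m_def by (intro tendsto_Lim) auto
  then show ?thesis using L unfolding m_def by simp
qed

lemma fourier_coeff_diff:
  assumes "B_ap f" "B_ap g"
  shows "fourier_coeff (\<lambda>x. f x - g x) \<nu> = fourier_coeff f \<nu> - fourier_coeff g \<nu>"
proof -
  have ai: "f absolutely_integrable_on {a..b}" "g absolutely_integrable_on {a..b}" for a b
    using assms by (auto simp: B_ap_def)
  have "((\<lambda>T. (1 / T) *\<^sub>R integral {0..T} (\<lambda>x. (f x - g x) * cis (- \<nu> * x)))
      \<longlongrightarrow> fourier_coeff f \<nu> - fourier_coeff g \<nu>) at_top"
    unfolding mean_diff [OF ai] by (intro tendsto_diff B_ap_mean_tendsto assms)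
  then show ?thesis
    unfolding fourier_coeff_def mean_value_def by (intro tendsto_Lim) auto
qed

section \<open>Best approximation and modulus of smoothness\<close>

lemma exponent_seq_abs_less:
  assumes "exponent_seq lam" "\<bar>j\<bar> < \<bar>k\<bar>"
  shows "\<bar>lam j\<bar> < \<bar>lam k\<bar>"
proof -
  have ex: "lam 0 = 0" "\<And>k. lam (- k) = - lam k" "\<And>k. k \<ge> 1 \<Longrightarrow> 0 < lam k \<and> lam k < lam (k + 1)"
    using assms(1) by (auto simp: exponent_seq_def)
  have "strict_mono (\<lambda>m. lam (int m))"
    unfolding strict_mono_Suc_iff
  proof
    fix m show "lam (int m) < lam (int (Suc m))"
      using ex(3) [of "int m"] ex(3) [of 1] ex(1) by (cases "m = 0") (auto simp: add.commute)
  qed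
  then have mono: "lam i < lam i'" if "0 \<le> i" "i < i'" for i i'
    using strict_monoD [of "\<lambda>m. lam (int m)" "nat i" "nat i'"] that by simp
  have "\<bar>lam i\<bar> = lam \<bar>i\<bar>" for i
    using ex(2) [of i] mono [of 0 "\<bar>i\<bar>"] ex(1) by (cases "i = 0"; cases "0 \<le> i") auto
  then show ?thesis
    using mono [of "\<bar>j\<bar>" "\<bar>k\<bar>"] assms(2) by simp
qed

lemma exponent_seq_abs_less_iff:
  assumes "exponent_seq lam"
  shows "\<bar>lam k\<bar> < lam (int n) \<longleftrightarrow> \<bar>k\<bar> < int n"
proof -
  have "lam (- int n) = - lam (int n)" "lam 0 = 0"
    using assms by (auto simp: exponent_seq_def)
  moreover have "0 \<le> lam (int n)"
    using assms by (cases "n = 0") (auto simp: exponent_seq_def intro!: less_imp_le)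
  moreover have "\<bar>k\<bar> = int n \<Longrightarrow> k = int n \<or> k = - int n"
    by auto
  ultimately show ?thesis
    using exponent_seq_abs_less [OF assms, of k "int n"] exponent_seq_abs_less [OF assms, of "int n" k]
    by (cases "\<bar>k\<bar>" "int n" rule: linorder_cases) auto
qed

lemma sum_le_infsum_ennreal:
  fixes x :: "'a \<Rightarrow> ennreal"
  assumes "finite F" "F \<subseteq> A"
  shows "sum x F \<le> infsum x A"
proof -
  have "infsum x F \<le> infsum x A"
    by (rule infsum_mono_neutral) (use assms in \<open>auto intro: nonneg_summable_on_complete\<close>)
  then show ?thesis using assms by simp
qed

text \<open>The norm of the part of the Fourier series of \<open>f\<close> that no function with exponents in
  \<open>{- lam n<..<lam n}\<close> can change.\<close>
definition tail_norm ::
    "(int \<Rightarrow> real) \<Rightarrow> (int \<Rightarrow> real \<Rightarrow> real) \<Rightarrow> nat \<Rightarrow> (real \<Rightarrow> complex) \<Rightarrow> ennreal" where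
  "tail_norm lam M n f =
     (SUP \<gamma>\<in>Gamma_set M. \<Sum>\<^sub>\<infinity>k\<in>{k. int n \<le> \<bar>k\<bar>}. ennreal (\<gamma> k * cmod (fourier_coeff f (lam k))))"

text \<open>The norm depends only on the absolute values of the coefficients and is monotone in them. So the
  partial sum of the Fourier series of \<open>f\<close>, which cancels all coefficients that can be cancelled,
  is a best approximation, and any admissible \<open>g\<close> leaves the coefficients with \<open>\<bar>k\<bar> \<ge> n\<close> untouched.\<close>
lemma best_approx_eq_tail_norm:
  assumes lam: "exponent_seq lam" and f: "f \<in> B_ap_exponents lam"
  shows "best_approx lam M (lam (int n)) f = tail_norm lam M n f"
proof (rule antisym)
  define K where "K = lam ` {k. \<bar>k\<bar> < int n}"
  define g where "g = (\<lambda>x. \<Sum>\<mu>\<in>K. fourier_coeff f \<mu> * cis (\<mu> * x))"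
  have "{k. \<bar>k\<bar> < int n} = {- int n<..<int n}"
    by auto
  then have finK: "finite K"
    by (simp add: K_def)
  have g: "B_ap g"
    unfolding g_def by (rule B_ap_trig_sum) (use finK in \<open>auto simp: trig_sum_def\<close>)
  have cg: "fourier_coeff g \<nu> = (if \<nu> \<in> K then fourier_coeff f \<nu> else 0)" for \<nu>
    unfolding g_def by (rule fourier_coeff_trig_sum [OF finK])
  then have "fourier_exponents g \<subseteq> K"
    by (auto simp: fourier_exponents_def)
  moreover have "K \<subseteq> {- lam (int n)<..<lam (int n)}"
  proof
    fix \<mu> assume "\<mu> \<in> K"
    then obtain k where "\<mu> = lam k" "\<bar>k\<bar> < int n"
      by (auto simp: K_def)
    then have "\<bar>\<mu>\<bar> < lam (int n)"
      by (simp add: exponent_seq_abs_less_iff [OF lam])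
    then show "\<mu> \<in> {- lam (int n)<..<lam (int n)}"
      by (simp add: abs_less_iff)
  qed
  moreover have "K \<subseteq> range lam"
    by (auto simp: K_def)
  ultimately have gK: "g \<in> {g \<in> B_ap_exponents lam. fourier_exponents g \<subseteq> {- lam (int n)<..<lam (int n)}}"
    using g by (auto simp: B_ap_exponents_def)
  have K_iff: "lam k \<in> K \<longleftrightarrow> \<bar>k\<bar> < int n" for k
  proof
    assume "lam k \<in> K"
    then obtain j where "lam k = lam j" "\<bar>j\<bar> < int n"
      by (auto simp: K_def)
    then show "\<bar>k\<bar> < int n"
      by (simp flip: exponent_seq_abs_less_iff [OF lam])
  qed (simp add: K_def)
  have "fourier_coeff (\<lambda>x. f x - g x) (lam k) = (if \<bar>k\<bar> < int n then 0 else fourier_coeff f (lam k))" for k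
    using f g by (simp add: fourier_coeff_diff B_ap_exponents_def cg K_iff)
  then have "BS_norm lam M (\<lambda>x. f x - g x) = tail_norm lam M n f"
    unfolding BS_norm_def tail_norm_def by (intro SUP_cong refl infsum_cong_neutral) auto
  then show "best_approx lam M (lam (int n)) f \<le> tail_norm lam M n f"
    unfolding best_approx_def using gK by (metis (no_types, lifting) INF_lower)
next
  show "tail_norm lam M n f \<le> best_approx lam M (lam (int n)) f"
    unfolding best_approx_def
  proof (rule INF_greatest)
    fix g assume g: "g \<in> {g \<in> B_ap_exponents lam. fourier_exponents g \<subseteq> {- lam (int n)<..<lam (int n)}}"
    have "fourier_coeff (\<lambda>x. f x - g x) (lam k) = fourier_coeff f (lam k)" if "int n \<le> \<bar>k\<bar>" for k
    proof -
      have "lam k \<notin> fourier_exponents g"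
      proof
        assume "lam k \<in> fourier_exponents g"
        then have "\<bar>lam k\<bar> < lam (int n)"
          using g by (auto simp: abs_less_iff)
        then show False
          using that by (simp add: exponent_seq_abs_less_iff [OF lam])
      qed
      then have "fourier_coeff g (lam k) = 0"
        by (simp add: fourier_exponents_def)
      then show ?thesis
        using f g by (simp add: fourier_coeff_diff B_ap_exponents_def)
    qed
    then show "tail_norm lam M n f \<le> BS_norm lam M (\<lambda>x. f x - g x)"
      unfolding tail_norm_def BS_norm_def
      by (intro SUP_mono' infsum_mono_neutral nonneg_summable_on_complete) auto
  qed
qed

lemma phi_eq_sinpow: "phi \<alpha> t = 2 powr \<alpha> * sinpow \<alpha> t"
  by (simp add: phi_eq_sin sinpow_def)

lemma phi_abs: "phi \<alpha> \<bar>t\<bar> = phi \<alpha> t"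
  by (simp add: phi_def)

lemma nn_integral_phi:
  assumes "\<alpha> > 0"
  shows "(\<integral>\<^sup>+t\<in>{0..\<tau>}. ennreal (phi \<alpha> (\<theta> * t)) \<partial>lborel)
    = ennreal (2 powr \<alpha> * integral {0..\<tau>} (\<lambda>t. sinpow \<alpha> (\<theta> * t)))"
proof (rule nn_integral_has_integral_lebesgue')
  have "(\<lambda>t. sinpow \<alpha> (\<theta> * t)) integrable_on {0..\<tau>}"
    using assms by (auto intro!: integrable_continuous_interval
        continuous_on_compose2 [OF continuous_on_sinpow [of \<alpha> UNIV]] continuous_intros)
  from has_integral_mult_right [OF integrable_integral [OF this], of "2 powr \<alpha>"]
  show "((\<lambda>t. phi \<alpha> (\<theta> * t)) has_integral 2 powr \<alpha> * integral {0..\<tau>} (\<lambda>t. sinpow \<alpha> (\<theta> * t))) {0..\<tau>}"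
    by (simp add: phi_eq_sinpow)
qed (simp add: phi_def)

lemma borel_measurable_phi: "\<alpha> > 0 \<Longrightarrow> (\<lambda>t. phi \<alpha> (\<theta> * t)) \<in> borel_measurable borel"
  unfolding phi_eq_sinpow
  by (intro borel_measurable_continuous_onI continuous_intros
      continuous_on_compose2 [OF continuous_on_sinpow [of \<alpha> UNIV]]) auto

text \<open>For a single coefficient with \<open>\<bar>k\<bar> \<ge> n\<close> the ratio \<open>\<theta> k = \<bar>lam k\<bar> / lam n\<close> is at least 1, so the
  integral of its factor \<open>phi \<alpha> (\<theta> k * t)\<close> in the modulus is at least \<open>C\<close>. Only finitely
  many \<open>k\<close> are summed under the integral, so that no limit has to be exchanged with it; the modulus
  then dominates every such finite sum.\<close>
lemma tail_norm_le_integral_modulus: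
  assumes lam: "exponent_seq lam" and \<alpha>: "\<alpha> \<ge> 1" and \<tau>: "0 < \<tau>" "\<tau> \<le> 3 * pi / 4" and n: "n \<ge> 1"
    and C: "C = 2 powr \<alpha> * integral {0..\<tau>} (sinpow \<alpha>)" "C > 0"
  shows "tail_norm lam M n f \<le>
    ennreal (1 / C) * (\<integral>\<^sup>+t\<in>{0..\<tau>}. modulus lam M \<alpha> f (t / lam (int n)) \<partial>lborel)"
    (is "_ \<le> _ * ?I")
  unfolding tail_norm_def
proof (intro SUP_least infsum_le_finite_sums)
  fix \<gamma> F assume \<gamma>: "\<gamma> \<in> Gamma_set M" and F: "finite F" "F \<subseteq> {k. int n \<le> \<bar>k\<bar>}"
  define L where "L = lam (int n)"
  have L: "L > 0"
    using lam n by (auto simp: exponent_seq_def L_def)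
  have \<gamma>_pos: "0 \<le> \<gamma> k" for k
    using \<gamma> by (auto simp: Gamma_set_def less_imp_le)
  define a where "a k = \<gamma> k * cmod (fourier_coeff f (lam k))" for k
  have a: "0 \<le> a k" for k
    by (simp add: a_def \<gamma>_pos)
  define \<theta> where "\<theta> k = \<bar>lam k\<bar> / L" for k
  have \<theta>: "1 \<le> \<theta> k" if "k \<in> F" for k
    using that F L exponent_seq_abs_less_iff [OF lam, of k n] by (auto simp: \<theta>_def L_def)
  have "ennreal C * (\<Sum>k\<in>F. ennreal (a k)) = (\<Sum>k\<in>F. ennreal (a k) * ennreal C)"
    by (simp add: sum_distrib_left mult.commute)
  also have "\<dots> \<le> (\<Sum>k\<in>F. ennreal (a k) * (\<integral>\<^sup>+t\<in>{0..\<tau>}. ennreal (phi \<alpha> (\<theta> k * t)) \<partial>lborel))"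
  proof (intro sum_mono mult_left_mono)
    fix k assume "k \<in> F"
    then show "ennreal C \<le> (\<integral>\<^sup>+t\<in>{0..\<tau>}. ennreal (phi \<alpha> (\<theta> k * t)) \<partial>lborel)"
      using \<alpha> \<tau> \<theta> integral_sinpow_scaled_ge [of \<alpha> "\<theta> k" \<tau>]
      by (simp add: C(1) nn_integral_phi ennreal_leI)
  qed simp
  also have "\<dots> = (\<integral>\<^sup>+t. (\<Sum>k\<in>F. ennreal (a k) * (ennreal (phi \<alpha> (\<theta> k * t)) * indicator {0..\<tau>} t)) \<partial>lborel)"
    using borel_measurable_phi [of \<alpha>] \<alpha>
    by (subst nn_integral_sum) (auto simp: nn_integral_cmult)
  also have "\<dots> \<le> ?I"
  proof (intro nn_integral_mono)
    fix t :: real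
    show "(\<Sum>k\<in>F. ennreal (a k) * (ennreal (phi \<alpha> (\<theta> k * t)) * indicator {0..\<tau>} t))
      \<le> modulus lam M \<alpha> f (t / lam (int n)) * indicator {0..\<tau>} t"
    proof (cases "t \<in> {0..\<tau>}")
      case True
      have "ennreal (a k) * ennreal (phi \<alpha> (\<theta> k * t))
          = ennreal (\<gamma> k * phi \<alpha> (lam k * (t / L)) * cmod (fourier_coeff f (lam k)))" for k
      proof -
        have "\<theta> k * t = \<bar>lam k * (t / L)\<bar>"
          using True L by (simp add: \<theta>_def abs_mult)
        then have "phi \<alpha> (\<theta> k * t) = phi \<alpha> (lam k * (t / L))"
          by (simp only: phi_abs)
        then show ?thesis
          by (simp add: a_def \<gamma>_pos phi_def mult_ac flip: ennreal_mult)
      qed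
      then have "(\<Sum>k\<in>F. ennreal (a k) * ennreal (phi \<alpha> (\<theta> k * t)))
          = (\<Sum>k\<in>F. ennreal (\<gamma> k * phi \<alpha> (lam k * (t / L)) * cmod (fourier_coeff f (lam k))))"
        by simp
      also have "\<dots> \<le> (\<Sum>\<^sub>\<infinity>k\<in>UNIV. ennreal (\<gamma> k * phi \<alpha> (lam k * (t / L)) * cmod (fourier_coeff f (lam k))))"
        using F by (intro sum_le_infsum_ennreal) auto
      also have "\<dots> \<le> modulus lam M \<alpha> f (t / L)"
        unfolding modulus_def
        \<comment> \<open>the shift \<open>h = t / lam n\<close>, the largest one admitted, already suffices\<close>
        by (rule SUP_upper2 [of "t / L"], use True L in simp, rule SUP_upper [OF \<gamma>])
      finally show ?thesis
        using True by (simp add: L_def)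
    qed simp
  qed
  finally have "ennreal C * (\<Sum>k\<in>F. ennreal (a k)) \<le> ?I" .
  then have "ennreal (1 / C) * (ennreal C * (\<Sum>k\<in>F. ennreal (a k))) \<le> ennreal (1 / C) * ?I"
    by (intro mult_left_mono) auto
  moreover have "ennreal (1 / C) * ennreal C = 1"
    using C(2) by (simp flip: ennreal_mult)
  ultimately show "(\<Sum>k\<in>F. ennreal (\<gamma> k * cmod (fourier_coeff f (lam k)))) \<le> ennreal (1 / C) * ?I"
    by (simp add: a_def flip: mult.assoc)
qed (simp add: nonneg_summable_on_complete)

text \<open>When only the exponents \<open>0\<close> and \<open>\<plusminus> lam n\<close> occur, the constant term is annihilated by \<open>phi \<alpha> 0 = 0\<close>
  and the other two carry the common factor \<open>phi \<alpha> (lam n * h)\<close>, which is largest for the largest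
  shift as long as \<open>t \<le> pi\<close>.\<close>
lemma modulus_le_tail_norm:
  assumes lam: "exponent_seq lam" and \<alpha>: "\<alpha> > 0" and n: "n \<ge> 1" and t: "0 \<le> t" "t \<le> pi"
    and f: "\<And>k. k \<noteq> 0 \<Longrightarrow> \<bar>k\<bar> \<noteq> int n \<Longrightarrow> fourier_coeff f (lam k) = 0"
  shows "modulus lam M \<alpha> f (t / lam (int n)) \<le> ennreal (phi \<alpha> t) * tail_norm lam M n f"
  unfolding modulus_def
proof (intro SUP_least infsum_le_finite_sums)
  fix h \<gamma> and F :: "int set"
  assume h: "h \<in> {h. \<bar>h\<bar> \<le> t / lam (int n)}" and \<gamma>: "\<gamma> \<in> Gamma_set M" and F: "finite F"
  define a where "a k = \<gamma> k * cmod (fourier_coeff f (lam k))" for k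
  have L: "lam (int n) > 0"
    using lam n by (auto simp: exponent_seq_def)
  have \<gamma>_pos: "0 \<le> \<gamma> k" for k
    using \<gamma> by (auto simp: Gamma_set_def less_imp_le)
  have phi: "phi \<alpha> (lam k * h) \<le> phi \<alpha> t" if "\<bar>k\<bar> = int n" for k
  proof -
    have "lam (- int n) = - lam (int n)" "k = int n \<or> k = - int n"
      using that lam by (auto simp: exponent_seq_def)
    then have "\<bar>lam k\<bar> = lam (int n)"
      using L by auto
    then have "\<bar>lam k * h\<bar> \<le> t"
      using h L by (simp add: abs_mult field_simps)
    then have "sinpow \<alpha> \<bar>lam k * h\<bar> \<le> sinpow \<alpha> t"
      using \<alpha> t by (intro sinpow_mono) auto
    then show ?thesis
      by (subst phi_abs [symmetric]) (simp add: phi_eq_sinpow)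
  qed
  have "(\<Sum>k\<in>F. ennreal (\<gamma> k * phi \<alpha> (lam k * h) * cmod (fourier_coeff f (lam k))))
      \<le> (\<Sum>k\<in>F \<inter> {k. int n \<le> \<bar>k\<bar>}. ennreal (phi \<alpha> t) * ennreal (a k))"
  proof (subst sum.inter_restrict [OF F], rule sum_mono)
    fix k
    consider "k = 0" | "k \<noteq> 0" "\<bar>k\<bar> \<noteq> int n" | "\<bar>k\<bar> = int n" by blast
    then show "ennreal (\<gamma> k * phi \<alpha> (lam k * h) * cmod (fourier_coeff f (lam k)))
      \<le> (if k \<in> {k. int n \<le> \<bar>k\<bar>} then ennreal (phi \<alpha> t) * ennreal (a k) else 0)"
    proof cases
      case 1
      then have "phi \<alpha> (lam k * h) = 0"
        using lam \<alpha> by (simp add: exponent_seq_def phi_def)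
      then show ?thesis by simp
    next
      case 2
      then show ?thesis using f by simp
    next
      case 3
      have "\<gamma> k * phi \<alpha> (lam k * h) * cmod (fourier_coeff f (lam k)) \<le> phi \<alpha> t * a k"
        using mult_right_mono [OF phi [OF 3], of "a k"] \<gamma>_pos by (simp add: a_def mult_ac)
      then show ?thesis
        using 3 \<gamma>_pos by (simp add: a_def phi_def ennreal_leI flip: ennreal_mult)
    qed
  qed
  also have "\<dots> = ennreal (phi \<alpha> t) * (\<Sum>k\<in>F \<inter> {k. int n \<le> \<bar>k\<bar>}. ennreal (a k))"
    by (simp add: sum_distrib_left)
  also have "(\<Sum>k\<in>F \<inter> {k. int n \<le> \<bar>k\<bar>}. ennreal (a k)) \<le> (\<Sum>\<^sub>\<infinity>k\<in>{k. int n \<le> \<bar>k\<bar>}. ennreal (a k))"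
    using F by (intro sum_le_infsum_ennreal) auto
  also have "\<dots> \<le> tail_norm lam M n f"
    unfolding tail_norm_def a_def by (rule SUP_upper [OF \<gamma>])
  finally show "(\<Sum>k\<in>F. ennreal (\<gamma> k * phi \<alpha> (lam k * h) * cmod (fourier_coeff f (lam k))))
      \<le> ennreal (phi \<alpha> t) * tail_norm lam M n f"
    by (simp add: mult_left_mono)
qed (simp add: nonneg_summable_on_complete)

lemma integral_modulus_le_tail_norm:
  assumes "exponent_seq lam" and \<alpha>: "\<alpha> > 0" and "n \<ge> 1" and "\<tau> \<le> pi"
    and f: "\<And>k. k \<noteq> 0 \<Longrightarrow> \<bar>k\<bar> \<noteq> int n \<Longrightarrow> fourier_coeff f (lam k) = 0"
    and C: "C = 2 powr \<alpha> * integral {0..\<tau>} (sinpow \<alpha>)" "C > 0"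
  shows "ennreal (1 / C) * (\<integral>\<^sup>+t\<in>{0..\<tau>}. modulus lam M \<alpha> f (t / lam (int n)) \<partial>lborel)
    \<le> tail_norm lam M n f"
proof -
  have "(\<integral>\<^sup>+t\<in>{0..\<tau>}. modulus lam M \<alpha> f (t / lam (int n)) \<partial>lborel)
      \<le> (\<integral>\<^sup>+t. ennreal (phi \<alpha> (1 * t)) * indicator {0..\<tau>} t * tail_norm lam M n f \<partial>lborel)"
    using modulus_le_tail_norm [of lam \<alpha> n _ f M] assms
    by (intro nn_integral_mono) (auto simp: indicator_def)
  also have "\<dots> = (\<integral>\<^sup>+t\<in>{0..\<tau>}. ennreal (phi \<alpha> (1 * t)) \<partial>lborel) * tail_norm lam M n f"
    using borel_measurable_phi [OF \<alpha>, of 1] by (intro nn_integral_multc) auto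
  also have "\<dots> = ennreal C * tail_norm lam M n f"
    unfolding nn_integral_phi [OF \<alpha>] by (simp add: C(1))
  finally have "ennreal (1 / C) * (\<integral>\<^sup>+t\<in>{0..\<tau>}. modulus lam M \<alpha> f (t / lam (int n)) \<partial>lborel)
      \<le> ennreal (1 / C) * (ennreal C * tail_norm lam M n f)"
    by (intro mult_left_mono) auto
  also have "\<dots> = tail_norm lam M n f"
    using C(2) by (simp flip: mult.assoc ennreal_mult)
  finally show ?thesis .
qed

lemma integral_sinpow_pos:
  assumes "\<alpha> > 0" "0 < \<tau>" "\<tau> \<le> pi"
  shows "0 < integral {0..\<tau>} (sinpow \<alpha>)"
proof -
  have "0 \<le> integral {0..\<tau> / 2} (sinpow \<alpha>)"
    using assms by (intro Henstock_Kurzweil_Integration.integral_nonneg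
        integrable_continuous_interval continuous_on_sinpow) (auto simp: sinpow_nonneg)
  moreover have "integral {0..\<tau> / 2} (sinpow \<alpha>) + sinpow \<alpha> (\<tau> / 2) * (\<tau> - \<tau> / 2) \<le> integral {0..\<tau>} (sinpow \<alpha>)"
    by (rule integral_initial_step) (use assms in \<open>auto intro!: continuous_on_sinpow sinpow_mono\<close>)
  moreover have "0 < sinpow \<alpha> (\<tau> / 2)"
    using assms sin_gt_zero [of "\<tau> / 4"] by (simp add: sinpow_def)
  then have "0 < sinpow \<alpha> (\<tau> / 2) * (\<tau> - \<tau> / 2)"
    using assms by (intro mult_pos_pos) auto
  ultimately show ?thesis by linarith
qed

theorem corollary3p3:
  fixes lam :: "int \<Rightarrow> real" and M :: "int \<Rightarrow> real \<Rightarrow> real"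
    and \<alpha> \<tau> :: real and n :: nat
  assumes "exponent_seq lam"
    and "\<And>k. orlicz_function (M k)"
    and "\<alpha> \<ge> 1"
    and "0 < \<tau>" and "\<tau> \<le> 3 * pi / 4"
    and "n \<ge> 1"
  shows "(\<forall>f \<in> BS_space lam M. form_F lam f \<longrightarrow>
            best_approx lam M (lam (int n)) f \<le>
              ennreal (1 / (2 powr \<alpha> * integral {0..\<tau>} (\<lambda>t. sin (t / 2) powr \<alpha>))) *
              (\<integral>\<^sup>+t\<in>{0..\<tau>}. modulus lam M \<alpha> f (t / lam (int n)) \<partial>lborel)) \<and>
         (\<forall>(\<gamma>::complex) (\<beta>::complex) (\<delta>::complex) f.
            f = (\<lambda>x. \<gamma> + \<beta> * cis (- lam (int n) * x) + \<delta> * cis (lam (int n) * x)) \<longrightarrow>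
            best_approx lam M (lam (int n)) f =
              ennreal (1 / (2 powr \<alpha> * integral {0..\<tau>} (\<lambda>t. sin (t / 2) powr \<alpha>))) *
              (\<integral>\<^sup>+t\<in>{0..\<tau>}. modulus lam M \<alpha> f (t / lam (int n)) \<partial>lborel))"
proof -
  define C where "C = 2 powr \<alpha> * integral {0..\<tau>} (sinpow \<alpha>)"
  have \<alpha>: "\<alpha> > 0" and \<tau>: "\<tau> \<le> pi"
    using assms by auto
  have "integral {0..\<tau>} (\<lambda>t. sin (t / 2) powr \<alpha>) = integral {0..\<tau>} (sinpow \<alpha>)"
    using \<tau> by (intro integral_cong) (simp add: sinpow_def sin_ge_zero)
  then have C_eq: "2 powr \<alpha> * integral {0..\<tau>} (\<lambda>t. sin (t / 2) powr \<alpha>) = C"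
    by (simp add: C_def)
  have C: "C > 0"
    using integral_sinpow_pos [OF \<alpha> \<open>0 < \<tau>\<close> \<tau>] by (simp add: C_def)
  note upper = tail_norm_le_integral_modulus [OF assms(1,3-6) C_def C]
  have extremal: "best_approx lam M (lam (int n)) f =
      ennreal (1 / C) * (\<integral>\<^sup>+t\<in>{0..\<tau>}. modulus lam M \<alpha> f (t / lam (int n)) \<partial>lborel)"
    if "f = (\<lambda>x. \<gamma> + \<beta> * cis (- lam (int n) * x) + \<delta> * cis (lam (int n) * x))" for \<gamma> \<beta> \<delta> f
  proof -
    define L where "L = lam (int n)"
    have L: "L > 0"
      using assms(1) \<open>n \<ge> 1\<close> by (auto simp: exponent_seq_def L_def)
    define a where "a \<mu> = (if \<mu> = 0 then \<gamma> else if \<mu> = L then \<delta> else \<beta>)" for \<mu>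
    have f_sum: "f = (\<lambda>x. \<Sum>\<mu>\<in>{0, L, - L}. a \<mu> * cis (\<mu> * x))"
      using L by (simp add: that a_def L_def [symmetric] fun_eq_iff)
    have coeff: "fourier_coeff f \<nu> = 0" if "\<nu> \<notin> {0, L, - L}" for \<nu>
      unfolding f_sum by (subst fourier_coeff_trig_sum) (use that in auto)
    have lam_n: "lam 0 = 0" "lam (- int n) = - L"
      using assms(1) by (auto simp: exponent_seq_def L_def)
    have "{0, L, - L} \<subseteq> range lam"
      using lam_n [symmetric] by (auto simp: L_def)
    moreover have "fourier_exponents f \<subseteq> {0, L, - L}"
      using coeff by (auto simp: fourier_exponents_def simp del: insert_iff)
    ultimately have exps: "fourier_exponents f \<subseteq> range lam"
      by (rule subset_trans [rotated])
    have "trig_sum f"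
      unfolding trig_sum_def
      by (rule exI [of _ "{0, L, - L}"], rule exI [of _ a]) (simp flip: f_sum)
    then have "B_ap f"
      by (rule B_ap_trig_sum)
    then have "f \<in> B_ap_exponents lam"
      using exps by (simp add: B_ap_exponents_def)
    then have "best_approx lam M (lam (int n)) f = tail_norm lam M n f"
      by (rule best_approx_eq_tail_norm [OF assms(1)])
    moreover have "fourier_coeff f (lam k) = 0" if "k \<noteq> 0" "\<bar>k\<bar> \<noteq> int n" for k
    proof (rule coeff)
      have "0 < \<bar>lam k\<bar>" "\<bar>lam k\<bar> < \<bar>L\<bar> \<or> \<bar>L\<bar> < \<bar>lam k\<bar>"
        using that exponent_seq_abs_less [OF assms(1), of 0 k]
          exponent_seq_abs_less [OF assms(1), of k "int n"]
          exponent_seq_abs_less [OF assms(1), of "int n" k]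
          linorder_less_linear [of "\<bar>k\<bar>" "int n"] by (auto simp: L_def)
      then show "lam k \<notin> {0, L, - L}" by auto
    qed
    ultimately show ?thesis
      using upper [of M f] integral_modulus_le_tail_norm [OF assms(1) \<alpha> \<open>n \<ge> 1\<close> \<tau> _ C_def C, of f M]
      by (auto intro: antisym)
  qed
  show ?thesis
    unfolding C_eq
  proof (intro conjI ballI impI allI)
    fix f assume "f \<in> BS_space lam M"
    then have "f \<in> B_ap_exponents lam"
      by (simp add: BS_space_def)
    then show "best_approx lam M (lam (int n)) f \<le>
        ennreal (1 / C) * (\<integral>\<^sup>+t\<in>{0..\<tau>}. modulus lam M \<alpha> f (t / lam (int n)) \<partial>lborel)"
      using upper by (simp add: best_approx_eq_tail_norm [OF assms(1)])
  qed (rule extremal)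
qed

end
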